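(* Let $A, B, C$ be semigroups, and let $P:B\to A$ and $P':B\to C$ be mappings such that $\mathcal{M}(A;B;P)/\theta_{\mathcal{M}(A;B;P)}\cong\mathcal{M}(C;B;P')$ (so that $A,B,C$ is a right regular triple). Suppose that $P'$ is surjective. If $A$ is left equalizer simple, then $C$ is left cancellative.
   Context: A semigroup is a nonempty set with an associative multiplication. For a semigroup $S$, a nonempty set $\Lambda$ and a mapping $P:\Lambda\to S$, let $\mathcal{M}(S;\Lambda;P)$ denote the semigroup on the set $S\times\Lambda$ with multiplication $(s,\lambda)(t,\mu)=(sP(\lambda)t,\mu)$. For a semigroup $S$, $\theta_S=\{(a,b)\in S\times S: xa=xb \text{ for all } x\in S\}$; this is a congruence on $S$. A triple $A,B,C$ of semigroups is called right regular if there exist mappings (not necessarily homomorphisms) $P:B\to A$ and $P':B\to C$ such that $\mathcal{M}(A;B;P)/\theta_{\mathcal{M}(A;B;P)}\cong\mathcal{M}(C;B;P')$ as semigroups. A semigroup $S$ is left equalizer simple if, for all $a,b\in S$, whenever $xa=xb$ holds for some $x\in S$, then $ya=yb$ holds for all $y\in S$. A semigroup $S$ is left cancellative if $xa=xb$ implies $a=b$ for all $x,a,b\in S$. *)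

theory Defs
  imports "HOL-Algebra.Group"
begin

text \<open>
  Semigroups are represented by the record type \<open>monoid\<close>, so that \<open>hom\<close>, \<open>iso\<close> and \<open>\<cong>\<close> can be
  reused; these only refer to \<open>carrier\<close> and \<open>mult\<close>. The field \<open>one\<close> is never constrained,
  and is \<open>undefined\<close> in the structures constructed here.
\<close>

locale semigrp =
  fixes S (structure)
  assumes carrier_nonempty: "carrier S \<noteq> {}"
    and mult_closed: "\<lbrakk>x \<in> carrier S; y \<in> carrier S\<rbrakk> \<Longrightarrow> x \<otimes> y \<in> carrier S"
    and mult_assoc: "\<lbrakk>x \<in> carrier S; y \<in> carrier S; z \<in> carrier S\<rbrakk>
      \<Longrightarrow> (x \<otimes> y) \<otimes> z = x \<otimes> (y \<otimes> z)"

definition sandwich ::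
    "('a, 'm) monoid_scheme \<Rightarrow> 'l set \<Rightarrow> ('l \<Rightarrow> 'a) \<Rightarrow> ('a \<times> 'l) monoid" where
  "sandwich S L P =
    \<lparr>carrier = carrier S \<times> L,
     mult = (\<lambda>(s, l) (t, m). (s \<otimes>\<^bsub>S\<^esub> P l \<otimes>\<^bsub>S\<^esub> t, m)),
     one = undefined\<rparr>"

definition theta :: "('a, 'm) monoid_scheme \<Rightarrow> ('a \<times> 'a) set" where
  "theta S = {(a, b). a \<in> carrier S \<and> b \<in> carrier S \<and>
    (\<forall>x \<in> carrier S. x \<otimes>\<^bsub>S\<^esub> a = x \<otimes>\<^bsub>S\<^esub> b)}"

definition congruence :: "('a, 'm) monoid_scheme \<Rightarrow> ('a \<times> 'a) set \<Rightarrow> bool" where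
  "congruence S r \<longleftrightarrow> equiv (carrier S) r \<and>
    (\<forall>(a, b) \<in> r. \<forall>(c, d) \<in> r. (a \<otimes>\<^bsub>S\<^esub> c, b \<otimes>\<^bsub>S\<^esub> d) \<in> r)"

text \<open>
  For a congruence \<open>r\<close>, all products \<open>x \<otimes> y\<close> in the union below lie in the same class,
  so the union is just that class; see \<open>quotient_mult\<close>.
\<close>

definition quotient_semigrp ::
    "('a, 'm) monoid_scheme \<Rightarrow> ('a \<times> 'a) set \<Rightarrow> 'a set monoid" where
  "quotient_semigrp S r =
    \<lparr>carrier = carrier S // r,
     mult = (\<lambda>X Y. \<Union>x \<in> X. \<Union>y \<in> Y. r `` {x \<otimes>\<^bsub>S\<^esub> y}),
     one = undefined\<rparr>"

definition left_equalizer_simple :: "('a, 'm) monoid_scheme \<Rightarrow> bool" where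
  "left_equalizer_simple S \<longleftrightarrow>
    (\<forall>a \<in> carrier S. \<forall>b \<in> carrier S.
      (\<exists>x \<in> carrier S. x \<otimes>\<^bsub>S\<^esub> a = x \<otimes>\<^bsub>S\<^esub> b) \<longrightarrow>
      (\<forall>y \<in> carrier S. y \<otimes>\<^bsub>S\<^esub> a = y \<otimes>\<^bsub>S\<^esub> b))"

definition left_cancellative :: "('a, 'm) monoid_scheme \<Rightarrow> bool" where
  "left_cancellative S \<longleftrightarrow>
    (\<forall>x \<in> carrier S. \<forall>a \<in> carrier S. \<forall>b \<in> carrier S.
      x \<otimes>\<^bsub>S\<^esub> a = x \<otimes>\<^bsub>S\<^esub> b \<longrightarrow> a = b)"

lemma quotient_mult:
  assumes "congruence S r" "a \<in> carrier S" "b \<in> carrier S"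
  shows "r `` {a} \<otimes>\<^bsub>quotient_semigrp S r\<^esub> r `` {b} = r `` {a \<otimes>\<^bsub>S\<^esub> b}"
proof -
  have eq: "equiv (carrier S) r"
    and cong: "\<And>a b c d. (a, b) \<in> r \<Longrightarrow> (c, d) \<in> r \<Longrightarrow> (a \<otimes>\<^bsub>S\<^esub> c, b \<otimes>\<^bsub>S\<^esub> d) \<in> r"
    using assms(1) by (auto simp: congruence_def)
  have class_eq: "r `` {x \<otimes>\<^bsub>S\<^esub> y} = r `` {a \<otimes>\<^bsub>S\<^esub> b}" if "x \<in> r `` {a}" "y \<in> r `` {b}" for x y
    using equiv_class_eq[OF eq cong] that by blast
  have "a \<in> r `` {a}" "b \<in> r `` {b}"
    using eq assms(2,3) by (simp_all only: equiv_class_self)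
  then show ?thesis
    using class_eq unfolding quotient_semigrp_def monoid.simps by blast
qed

lemma (in semigrp) congruence_theta: "congruence S (theta S)"
proof -
  have "equiv (carrier S) (theta S)"
    by (intro equivI refl_onI symI transI) (auto simp: theta_def)
  moreover have "(a \<otimes> c, b \<otimes> d) \<in> theta S"
    if "(a, b) \<in> theta S" "(c, d) \<in> theta S" for a b c d
  proof -
    have mem: "a \<in> carrier S" "b \<in> carrier S" "c \<in> carrier S" "d \<in> carrier S"
      and ab: "\<And>x. x \<in> carrier S \<Longrightarrow> x \<otimes> a = x \<otimes> b"
      and cd: "\<And>x. x \<in> carrier S \<Longrightarrow> x \<otimes> c = x \<otimes> d"
      using that by (auto simp: theta_def)
    have "x \<otimes> (a \<otimes> c) = x \<otimes> (b \<otimes> d)" if x: "x \<in> carrier S" for x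
    proof -
      have "x \<otimes> (a \<otimes> c) = (x \<otimes> b) \<otimes> c"
        using mem x ab[OF x] by (simp flip: mult_assoc)
      also have "\<dots> = (x \<otimes> b) \<otimes> d"
        using cd mult_closed mem x by blast
      finally show ?thesis
        using mem x by (simp add: mult_assoc)
    qed
    then show ?thesis
      using mem mult_closed by (auto simp: theta_def)
  qed
  ultimately show ?thesis
    by (auto simp: congruence_def)
qed

lemma semigrp_sandwich:
  assumes "semigrp S" "L \<noteq> {}" "P \<in> L \<rightarrow> carrier S"
  shows "semigrp (sandwich S L P)"
proof -
  interpret semigrp S by fact
  show ?thesis
    using assms(2,3) carrier_nonempty
    by unfold_locales (auto simp: sandwich_def mult_assoc mult_closed Pi_iff)
qed

end

theory Submission
  imports Defs
begin

text \<open>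
  Left equalizer simplicity passes from \<open>A\<close> to the sandwich semigroup over \<open>A\<close>, and it makes the
  quotient by \<open>theta\<close> left cancellative. So the sandwich semigroup over \<open>C\<close> is left cancellative,
  and since every element of \<open>C\<close> is a value of \<open>P'\<close>, an equation \<open>x \<otimes> a = x \<otimes> b\<close> in \<open>C\<close>
  lifts to the equation \<open>(x, l) \<otimes> (a, l) = (x, l) \<otimes> (b, l)\<close> with \<open>P' l = x\<close>, which can be
  cancelled.
\<close>

text \<open>Left multiplication by \<open>(x, l)\<close> fixes the second component and multiplies
  the first by the single element \<open>x \<otimes> P l\<close> of \<open>S\<close>. Hence the
  property of \<open>S\<close> applies with \<open>x \<otimes> P l\<close> and
  \<open>y \<otimes> P k\<close> as multipliers.\<close>

lemma left_equalizer_simple_sandwich: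
  assumes "semigrp S" "P \<in> L \<rightarrow> carrier S" "left_equalizer_simple S"
  shows "left_equalizer_simple (sandwich S L P)"
proof -
  interpret semigrp S by fact
  have key: "y \<otimes>\<^bsub>S\<^esub> P k \<otimes>\<^bsub>S\<^esub> a = y \<otimes>\<^bsub>S\<^esub> P k \<otimes>\<^bsub>S\<^esub> b"
    if mem: "x \<in> carrier S" "y \<in> carrier S" "a \<in> carrier S" "b \<in> carrier S" "l \<in> L" "k \<in> L"
      and eq: "x \<otimes>\<^bsub>S\<^esub> P l \<otimes>\<^bsub>S\<^esub> a = x \<otimes>\<^bsub>S\<^esub> P l \<otimes>\<^bsub>S\<^esub> b" for x y a b l k
  proof -
    have "x \<otimes>\<^bsub>S\<^esub> P l \<in> carrier S" "y \<otimes>\<^bsub>S\<^esub> P k \<in> carrier S"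
      using mem assms(2) by (auto intro: mult_closed)
    then show ?thesis
      using assms(3) mem eq unfolding left_equalizer_simple_def by blast
  qed
  \<comment> \<open>Equality of the two products also forces equal second components, so only the
    equation of \<open>key\<close> remains.\<close>
  show ?thesis
    unfolding left_equalizer_simple_def sandwich_def by clarsimp (rule key)
qed

text \<open>An equation between classes only says that \<open>x \<otimes> a\<close> and
  \<open>x \<otimes> b\<close> agree after every left multiplication. One such multiplication
  exhibits an element equalizing \<open>a\<close> and \<open>b\<close>; by hypothesis every element
  then does, which is membership in \<open>theta S\<close>.\<close>

lemma left_cancellative_quotient_theta:
  assumes "semigrp S" "left_equalizer_simple S"
  shows "left_cancellative (quotient_semigrp S (theta S))"
proof -
  interpret semigrp S by fact
  have eqv: "equiv (carrier S) (theta S)"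
    using congruence_theta by (simp add: congruence_def)
  have cancel: "theta S `` {a} = theta S `` {b}"
    if mem: "x \<in> carrier S" "a \<in> carrier S" "b \<in> carrier S"
      and eq: "theta S `` {x \<otimes>\<^bsub>S\<^esub> a} = theta S `` {x \<otimes>\<^bsub>S\<^esub> b}" for x a b
  proof -
    have "(x \<otimes>\<^bsub>S\<^esub> a, x \<otimes>\<^bsub>S\<^esub> b) \<in> theta S"
      using eq_equiv_class[OF eq eqv] mem mult_closed by blast
    \<comment> \<open>The multiplier is taken to be \<open>x\<close> itself, so
      \<open>x \<otimes> x\<close> is the equalizing element.\<close>
    then have "x \<otimes>\<^bsub>S\<^esub> x \<otimes>\<^bsub>S\<^esub> a = x \<otimes>\<^bsub>S\<^esub> x \<otimes>\<^bsub>S\<^esub> b"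
      using mem by (auto simp: theta_def mult_assoc)
    moreover have "x \<otimes>\<^bsub>S\<^esub> x \<in> carrier S"
      using mem mult_closed by blast
    ultimately have "(a, b) \<in> theta S"
      using assms(2) mem unfolding left_equalizer_simple_def theta_def by blast
    then show ?thesis
      by (rule equiv_class_eq[OF eqv])
  qed
  have "Y = Z"
    if mem: "X \<in> carrier S // theta S" "Y \<in> carrier S // theta S" "Z \<in> carrier S // theta S"
      and eq: "X \<otimes>\<^bsub>quotient_semigrp S (theta S)\<^esub> Y = X \<otimes>\<^bsub>quotient_semigrp S (theta S)\<^esub> Z" for X Y Z
  proof -
    obtain x y z where rep: "x \<in> carrier S" "y \<in> carrier S" "z \<in> carrier S"
      and XYZ: "X = theta S `` {x}" "Y = theta S `` {y}" "Z = theta S `` {z}"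
      using mem by (meson quotientE)
    show ?thesis
      using cancel[OF rep] eq rep by (simp only: XYZ quotient_mult[OF congruence_theta])
  qed
  moreover have "carrier (quotient_semigrp S (theta S)) = carrier S // theta S"
    by (simp add: quotient_semigrp_def)
  ultimately show ?thesis
    unfolding left_cancellative_def by blast
qed

text \<open>Lets \<open>left_cancellative_iso\<close> be applied to the quotient by
  \<open>theta\<close>. The laws are inherited through representatives.\<close>

lemma (in semigrp) semigrp_quotient:
  assumes "congruence S r"
  shows "semigrp (quotient_semigrp S r)"
proof -
  have carrier: "carrier (quotient_semigrp S r) = carrier S // r"
    by (simp add: quotient_semigrp_def)
  show ?thesis
  proof
    show "carrier (quotient_semigrp S r) \<noteq> {}"
      using carrier_nonempty by (simp add: carrier quotient_is_empty)
  next
    fix X Y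
    assume "X \<in> carrier (quotient_semigrp S r)" "Y \<in> carrier (quotient_semigrp S r)"
    then show "X \<otimes>\<^bsub>quotient_semigrp S r\<^esub> Y \<in> carrier (quotient_semigrp S r)"
      unfolding carrier
      by (elim quotientE) (simp add: quotient_mult[OF assms] mult_closed quotientI)
  next
    fix X Y Z
    assume "X \<in> carrier (quotient_semigrp S r)" "Y \<in> carrier (quotient_semigrp S r)"
      "Z \<in> carrier (quotient_semigrp S r)"
    then show "X \<otimes>\<^bsub>quotient_semigrp S r\<^esub> Y \<otimes>\<^bsub>quotient_semigrp S r\<^esub> Z =
        X \<otimes>\<^bsub>quotient_semigrp S r\<^esub> (Y \<otimes>\<^bsub>quotient_semigrp S r\<^esub> Z)"
      unfolding carrier
      by (elim quotientE) (simp add: quotient_mult[OF assms] mult_closed mult_assoc)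
  qed
qed

lemma left_cancellative_iso:
  assumes "semigrp G" "G \<cong> H" "left_cancellative G"
  shows "left_cancellative H"
proof -
  interpret semigrp G by fact
  obtain h where h: "h \<in> hom G H" and bij: "bij_betw h (carrier G) (carrier H)"
    using assms(2) by (auto simp: is_iso_def iso_def)
  have "h a = h b"
    if mem: "x \<in> carrier G" "a \<in> carrier G" "b \<in> carrier G"
      and eq: "h x \<otimes>\<^bsub>H\<^esub> h a = h x \<otimes>\<^bsub>H\<^esub> h b" for x a b
  proof -
    have "h (x \<otimes>\<^bsub>G\<^esub> a) = h (x \<otimes>\<^bsub>G\<^esub> b)"
      using eq mem by (simp add: hom_mult[OF h])
    \<comment> \<open>Injectivity of \<open>h\<close> holds on the carrier, so closure of
      \<open>G\<close> under products is used here.\<close>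
    then have "x \<otimes>\<^bsub>G\<^esub> a = x \<otimes>\<^bsub>G\<^esub> b"
      using bij mem by (auto simp: bij_betw_def mult_closed dest: inj_onD)
    then show ?thesis
      using assms(3) mem unfolding left_cancellative_def by blast
  qed
  then show ?thesis
    \<comment> \<open>Surjectivity of \<open>h\<close> lets every element of \<open>H\<close> be
      written as an image.\<close>
    unfolding left_cancellative_def bij_betw_imp_surj_on[OF bij, symmetric] by blast
qed

lemma left_cancellative_of_sandwich:
  assumes "semigrp S" "P ` L = carrier S" "left_cancellative (sandwich S L P)"
  shows "left_cancellative S"
proof -
  interpret semigrp S by fact
  have "a = b"
    if mem: "x \<in> carrier S" "a \<in> carrier S" "b \<in> carrier S"
      and eq: "x \<otimes>\<^bsub>S\<^esub> a = x \<otimes>\<^bsub>S\<^esub> b" for x a b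
  proof -
    obtain l where l: "l \<in> L" "P l = x"
      using mem(1) unfolding assms(2)[symmetric] by blast
    \<comment> \<open>Since \<open>P l = x\<close>, the first components are
      \<open>x \<otimes> x \<otimes> a\<close> and \<open>x \<otimes> x \<otimes> b\<close>: the
      given equation multiplied on the left by \<open>x\<close>.\<close>
    have "(x, l) \<otimes>\<^bsub>sandwich S L P\<^esub> (a, l) = (x, l) \<otimes>\<^bsub>sandwich S L P\<^esub> (b, l)"
      using mem eq l by (simp add: sandwich_def mult_assoc mult_closed)
    moreover have "carrier (sandwich S L P) = carrier S \<times> L"
      by (simp add: sandwich_def)
    ultimately have "(a, l) = (b, l)"
      using assms(3) mem l(1) unfolding left_cancellative_def by blast
    then show ?thesis
      by simp
  qed
  then show ?thesis
    unfolding left_cancellative_def by blast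
qed

theorem theorem4:
  fixes A :: "('a, 'i) monoid_scheme"
    and B :: "('b, 'j) monoid_scheme"
    and C :: "('c, 'k) monoid_scheme"
    and P :: "'b \<Rightarrow> 'a" and P' :: "'b \<Rightarrow> 'c"
  assumes "semigrp A" and "semigrp B" and "semigrp C"
    and "P \<in> carrier B \<rightarrow> carrier A"
    and "P' \<in> carrier B \<rightarrow> carrier C"
    and "quotient_semigrp (sandwich A (carrier B) P) (theta (sandwich A (carrier B) P))
          \<cong> sandwich C (carrier B) P'"
    and "P' ` carrier B = carrier C"
    and "left_equalizer_simple A"
  shows "left_cancellative C"
proof -
  let ?M = "sandwich A (carrier B) P"
  let ?Q = "quotient_semigrp ?M (theta ?M)"
  \<comment> \<open>Unfolding \<open>semigrp_def\<close> supplies the nonempty index set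
    \<open>carrier B\<close> that \<open>semigrp_sandwich\<close> asks for.\<close>
  have M: "semigrp ?M"
    using assms(1,2,4) by (intro semigrp_sandwich) (auto simp: semigrp_def)
  then have "semigrp ?Q"
    by (intro semigrp.semigrp_quotient semigrp.congruence_theta)
  moreover have "left_equalizer_simple ?M"
    using assms(1,4,8) by (rule left_equalizer_simple_sandwich)
  with M have "left_cancellative ?Q"
    by (rule left_cancellative_quotient_theta)
  ultimately have "left_cancellative (sandwich C (carrier B) P')"
    using left_cancellative_iso[OF _ assms(6)] by simp
  with assms(3,7) show ?thesis
    by (rule left_cancellative_of_sandwich)
qed

end
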